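(* Suppose the feasibility assumption, the regularity assumption and the consistent-output assumption stated in the context hold, and let $(\bar x,\bar v_i)\in\mathcal{S}_i$ be a nondegenerate stationary point. Then there exists $r>0$ such that for every $(x,v_i)\in B((\bar x,\bar v_i),r)\cap\mathcal{S}_i$ the following hold: (i) $(x,v_i)$ is on the graph of a unique $C^1$ solution map $v_i^*(\cdot;(\bar x,\bar v_i))$. (ii) Let $x^+=x+p$ with $\|p\|\le r$. Let $\hat f_i(x)$ and $\hat f_i(x^+)$ be the values returned successively by the subproblem solver evaluated at $x$ (where it returned the stationary point $v_i$) and then at $x^+$ (started from $v_i$). If $\hat f_i(x)=\hat f_i(x;(\bar x,\bar v_i))$, then $\hat f_i(x^+)=\hat f_i(x^+;(\bar x,\bar v_i))$. (iii) The function $\hat f_i(\cdot;(\bar x,\bar v_i))$ restricted to $B(\bar x,r)$ is $C^2$.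
   Context: Two-stage problem: the first stage is $\min_{x\in\mathbb{R}^{n_0}} f_0(x)+\sum_{i=1}^N\hat f_i(x)$ subject to $c_0(x)\le 0$; the $i$-th second-stage problem (subproblem) parameterized by $x$ is $\min_{y_i\in\mathbb{R}^{n_i}} f_i(y_i;x)$ subject to $c_i(y_i;x)\le 0$, with $f_i:\mathbb{R}^{n_i}\times\mathbb{R}^{n_0}\to\mathbb{R}$ and $c_i:\mathbb{R}^{n_i}\times\mathbb{R}^{n_0}\to\mathbb{R}^{m_i}$, not necessarily convex. Fix a smoothing parameter $\mu>0$. The smoothed (barrier) subproblem is $$\min_{y_i,s_i,\tilde x_i} f_i(y_i;\tilde x_i)-\mu\sum_j\ln(s_{ij})\quad\text{s.t.}\quad c_i(y_i;\tilde x_i)+s_i=0\ [\lambda_i],\quad \tilde x_i-x=0\ [\eta_i],$$ with multipliers in brackets. Let $v_i=(y_i,\tilde x_i,s_i,\lambda_i,\eta_i)\in\mathbb{R}^{n_{v_i}}$, $\mathcal{L}_i=f_i(y_i;\tilde x_i)+(c_i(y_i;\tilde x_i)+s_i)^T\lambda_i+(\tilde x_i-x)^T\eta_i$, and $$F_i(v_i;x)=\big(\nabla_{y_i}\mathcal{L}_i,\ \nabla_{\tilde x_i}\mathcal{L}_i,\ s_i\circ\lambda_i-\mu e,\ c_i(y_i;\tilde x_i)+s_i,\ \tilde x_i-x\big),$$ where $\circ$ is the componentwise product and $e$ the all-ones vector. Let $\mathcal{S}_i$ be the set of $(x,v_i)\in\mathbb{R}^{n_0}\times\mathbb{R}^{n_{v_i}}$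 with $F_i(v_i;x)=0$ (and $s_i>0$, $\lambda_i>0$). A point $(x,v_i)\in\mathcal{S}_i$ is a nondegenerate stationary point if $\nabla_{v_i}F_i(v_i;x)$ is nonsingular. A solution map is a continuous map $v_i^*:U\to\mathbb{R}^{n_{v_i}}$ on a neighborhood $U\subset\mathbb{R}^{n_0}$ with $(x,v_i^*(x))\in\mathcal{S}_i$ for all $x\in U$; it has reference point $(\bar x,\bar v_i)$ if $v_i^*(\bar x)=\bar v_i$. $B(\cdot,r)$ is the open Euclidean ball. For each nondegenerate $(\bar x,\bar v_i)\in\mathcal{S}_i$ there are radii $r_1\ge r_2>0$ (fixed once and for all for that point) such that there is a unique $C^1$ solution map $v_i^*(\cdot;(\bar x,\bar v_i))=(y_i^*,\tilde x_i^*,s_i^*,\lambda_i^*,\eta_i^* )(\cdot;(\bar x,\bar v_i))$ on $B(\bar x,r_1)$ with reference point $(\bar x,\bar v_i)$, and its graph is the zero level set of $F_i$ inside $B((\bar x,\bar v_i),r_2)$. Local second-stage functions, defined near $\bar x$: for solution smoothing, $\hat f_i(x;(\bar x,\bar v_i))=f_i(y_i^*(x;(\bar x,\bar v_i));x)$; for objective smoothing, $\hat f_i(x;(\bar x,\bar v_i))=f_i(y_i^*(x;(\bar x,\bar v_i));x)-\mu\sum_j\ln(s_{ij}^*(x;(\bar x,\bar v_i)))$. The statement covers either choice. Subproblem solver: a procedure which, given an input $x$ and a starting point in $\mathbb{R}^{n_{v_i}}$, returns $v_i=(y_i,\tilde x_i,s_i,\lambda_i,\eta_i)$ with $(x,v_i)\in\mathcal{S}_i$.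 The value it returns at $x$ is $\hat f_i(x)=f_i(y_i;x)$ (solution smoothing) or $\hat f_i(x)=f_i(y_i;x)-\mu\sum_j\ln(s_{ij})$ (objective smoothing). The solver is warm-started: at a new input it is started from the most recent solution. Feasibility assumption: for any $x$ sent to the subproblems by the first-stage problem, the subproblem parameterized by $x$ is feasible and the subproblem solver always returns a KKT point of the smoothed subproblem. Regularity assumption: $f_0,c_0$ are $C^1$ with locally Lipschitz continuous first derivatives. If objective smoothing is used, $f_i(\cdot;\cdot)$ and $c_i(\cdot;\cdot)$ are $C^2$ with locally Lipschitz continuous second derivatives; if solution smoothing is used, $f_i(\cdot;\cdot)$ and $c_i(\cdot;\cdot)$ are $C^3$. Consistent-output assumption: for every nondegenerate $(\bar x,\bar v_i)\in\mathcal{S}_i$ there exists $r_3>0$ such that: if $v_i^k$ is the stationary point computed by the solver for $x^k$ (so $(x^k,v_i^k)\in\mathcal{S}_i$) and $(x^k,v_i^k)\in B((\bar x,\bar v_i),r_3)$, then when the solver is started from $v_i^k$ for an input $x^+=x^k+p$ with $\|p\|\le r_3$, the stationary point $v_i^+$ it computes satisfies $(x^+,v_i^+)\in B((\bar x,\bar v_i),r_2)$, with $r_2$ the radius above. *)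

theory Defs
  imports "HOL-Analysis.Analysis"
begin

(* Differentiability classes of maps between normed spaces, on an open set U.  Derivatives are
   bounded linear maps, so iterated derivatives live in iterated spaces of such maps and
   continuity and Lipschitz continuity are with respect to the operator norm. *)

definition derivative_on ::
  "'a::real_normed_vector set \<Rightarrow> ('a \<Rightarrow> 'b::real_normed_vector) \<Rightarrow> ('a \<Rightarrow> 'a \<Rightarrow>\<^sub>L 'b) \<Rightarrow> bool" where
  "derivative_on U g g' \<longleftrightarrow> (\<forall>x\<in>U. (g has_derivative blinfun_apply (g' x)) (at x))"

definition locally_lipschitz_on ::
  "'a::metric_space set \<Rightarrow> ('a \<Rightarrow> 'b::metric_space) \<Rightarrow> bool" where
  "locally_lipschitz_on U g \<longleftrightarrow> (\<forall>x\<in>U. \<exists>e>0. \<exists>L. L-lipschitz_on (ball x e \<inter> U) g)"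

definition C1_on ::
  "'a::real_normed_vector set \<Rightarrow> ('a \<Rightarrow> 'b::real_normed_vector) \<Rightarrow> bool" where
  "C1_on U g \<longleftrightarrow> (\<exists>g'. derivative_on U g g' \<and> continuous_on U g')"

definition C2_on ::
  "'a::real_normed_vector set \<Rightarrow> ('a \<Rightarrow> 'b::real_normed_vector) \<Rightarrow> bool" where
  "C2_on U g \<longleftrightarrow> (\<exists>g'. derivative_on U g g' \<and> C1_on U g')"

definition C3_on ::
  "'a::real_normed_vector set \<Rightarrow> ('a \<Rightarrow> 'b::real_normed_vector) \<Rightarrow> bool" where
  "C3_on U g \<longleftrightarrow> (\<exists>g'. derivative_on U g g' \<and> C2_on U g')"

(* C1 (respectively C2) with locally Lipschitz first (respectively second) derivatives. *)

definition C1_lipschitz_on ::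
  "'a::real_normed_vector set \<Rightarrow> ('a \<Rightarrow> 'b::real_normed_vector) \<Rightarrow> bool" where
  "C1_lipschitz_on U g \<longleftrightarrow> (\<exists>g'. derivative_on U g g' \<and> locally_lipschitz_on U g')"

definition C2_lipschitz_on ::
  "'a::real_normed_vector set \<Rightarrow> ('a \<Rightarrow> 'b::real_normed_vector) \<Rightarrow> bool" where
  "C2_lipschitz_on U g \<longleftrightarrow> (\<exists>g'. derivative_on U g g' \<and> C1_lipschitz_on U g')"

definition grad :: "('a::real_inner \<Rightarrow> real) \<Rightarrow> 'a \<Rightarrow> 'a" where
  "grad g x = (THE D. GDERIV g x :> D)"

(* One subproblem: objective f and constraints c are functions of the pair (y, x).
   Primal-dual variables v = (y, xt, s, lam, eta), where xt is the local copy of x and lam, eta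
   are the multipliers of c(y; xt) + s = 0 and xt - x = 0.  The norm of a product type is the
   Euclidean one, so "ball" is the open Euclidean ball also for tuples. *)

type_synonym ('n, 'n0, 'm) pd_vars =
  "(real^'n) \<times> (real^'n0) \<times> (real^'m) \<times> (real^'m) \<times> (real^'n0)"

definition lagrangian ::
  "((real^'n) \<times> (real^'n0) \<Rightarrow> real) \<Rightarrow> ((real^'n) \<times> (real^'n0) \<Rightarrow> real^'m) \<Rightarrow>
   real^'n0 \<Rightarrow> ('n, 'n0, 'm) pd_vars \<Rightarrow> real" where
  "lagrangian f c x = (\<lambda>(y, xt, s, lam, eta).
     f (y, xt) + (c (y, xt) + s) \<bullet> lam + (xt - x) \<bullet> eta)"

definition kkt_map ::
  "((real^'n) \<times> (real^'n0) \<Rightarrow> real) \<Rightarrow> ((real^'n) \<times> (real^'n0) \<Rightarrow> real^'m) \<Rightarrow> real \<Rightarrow>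
   ('n, 'n0, 'm) pd_vars \<Rightarrow> real^'n0 \<Rightarrow>
   (real^'n) \<times> (real^'n0) \<times> (real^'m) \<times> (real^'m) \<times> (real^'n0)" where
  "kkt_map f c \<mu> = (\<lambda>(y, xt, s, lam, eta) x.
     (grad (\<lambda>y'. lagrangian f c x (y', xt, s, lam, eta)) y,
      grad (\<lambda>xt'. lagrangian f c x (y, xt', s, lam, eta)) xt,
      (\<chi> j. s $ j * lam $ j - \<mu>),
      c (y, xt) + s,
      xt - x))"

definition stationary_set ::
  "((real^'n) \<times> (real^'n0) \<Rightarrow> real) \<Rightarrow> ((real^'n) \<times> (real^'n0) \<Rightarrow> real^'m) \<Rightarrow> real \<Rightarrow>
   ((real^'n0) \<times> ('n, 'n0, 'm) pd_vars) set" where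
  "stationary_set f c \<mu> = {(x, (y, xt, s, lam, eta)) | x y xt s lam eta.
     kkt_map f c \<mu> (y, xt, s, lam, eta) x = 0 \<and> (\<forall>j. 0 < s $ j) \<and> (\<forall>j. 0 < lam $ j)}"

definition nondegenerate ::
  "((real^'n) \<times> (real^'n0) \<Rightarrow> real) \<Rightarrow> ((real^'n) \<times> (real^'n0) \<Rightarrow> real^'m) \<Rightarrow> real \<Rightarrow>
   (real^'n0) \<times> ('n, 'n0, 'm) pd_vars \<Rightarrow> bool" where
  "nondegenerate f c \<mu> P \<longleftrightarrow> P \<in> stationary_set f c \<mu> \<and>
     (\<exists>D. ((\<lambda>v. kkt_map f c \<mu> v (fst P)) has_derivative D) (at (snd P)) \<and> bij D)"

definition solution_map ::
  "((real^'n) \<times> (real^'n0) \<Rightarrow> real) \<Rightarrow> ((real^'n) \<times> (real^'n0) \<Rightarrow> real^'m) \<Rightarrow> real \<Rightarrow>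
   (real^'n0) set \<Rightarrow> (real^'n0 \<Rightarrow> ('n, 'n0, 'm) pd_vars) \<Rightarrow> bool" where
  "solution_map f c \<mu> U w \<longleftrightarrow>
     open U \<and> continuous_on U w \<and> (\<forall>x\<in>U. (x, w x) \<in> stationary_set f c \<mu>)"

definition C1_solution_map ::
  "((real^'n) \<times> (real^'n0) \<Rightarrow> real) \<Rightarrow> ((real^'n) \<times> (real^'n0) \<Rightarrow> real^'m) \<Rightarrow> real \<Rightarrow>
   (real^'n0) set \<Rightarrow> (real^'n0 \<Rightarrow> ('n, 'n0, 'm) pd_vars) \<Rightarrow> bool" where
  "C1_solution_map f c \<mu> U w \<longleftrightarrow> solution_map f c \<mu> U w \<and> C1_on U w"

definition has_reference_point ::
  "(real^'n0 \<Rightarrow> ('n::finite, 'n0, 'm::finite) pd_vars) \<Rightarrow> (real^'n0) \<times> ('n, 'n0, 'm) pd_vars \<Rightarrow> bool" where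
  "has_reference_point w P \<longleftrightarrow> w (fst P) = snd P"

(* w is the unique C1 solution map on the ball of radius r1 with reference point P, and its graph
   and the zero level set of the KKT map coincide inside the ball of radius r2 around P.  Functions
   are total here, so uniqueness means agreement on the r1-ball; the values of w outside that ball
   carry no meaning. *)

definition local_solution_map ::
  "((real^'n) \<times> (real^'n0) \<Rightarrow> real) \<Rightarrow> ((real^'n) \<times> (real^'n0) \<Rightarrow> real^'m) \<Rightarrow> real \<Rightarrow>
   real \<Rightarrow> real \<Rightarrow> (real^'n0) \<times> ('n, 'n0, 'm) pd_vars \<Rightarrow>
   (real^'n0 \<Rightarrow> ('n, 'n0, 'm) pd_vars) \<Rightarrow> bool" where
  "local_solution_map f c \<mu> r1 r2 P w \<longleftrightarrow>
     0 < r2 \<and> r2 \<le> r1 \<and>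
     C1_solution_map f c \<mu> (ball (fst P) r1) w \<and> has_reference_point w P \<and>
     (\<forall>w'. C1_solution_map f c \<mu> (ball (fst P) r1) w' \<and> has_reference_point w' P
        \<longrightarrow> (\<forall>x\<in>ball (fst P) r1. w' x = w x)) \<and>
     {(x, v). x \<in> ball (fst P) r1 \<and> v = w x} \<inter> ball P r2
       = {(x, v). kkt_map f c \<mu> v x = 0} \<inter> ball P r2"

datatype smoothing = Solution_Smoothing | Objective_Smoothing

(* The value attached to an input x and primal-dual variables v.  It gives both the value returned
   by the solver (v = solver output at x) and the local second-stage function (v = w x for the
   local solution map w).  The second argument of f is x itself, not the copy xt. *)

definition second_stage_value ::
  "smoothing \<Rightarrow> ((real^'n) \<times> (real^'n0) \<Rightarrow> real) \<Rightarrow> real \<Rightarrow>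
   real^'n0 \<Rightarrow> ('n, 'n0, 'm::finite) pd_vars \<Rightarrow> real" where
  "second_stage_value sm f \<mu> x = (\<lambda>(y, xt, s, lam, eta).
     (case sm of
        Solution_Smoothing \<Rightarrow> f (y, x)
      | Objective_Smoothing \<Rightarrow> f (y, x) - \<mu> * (\<Sum>j\<in>UNIV. ln (s $ j))))"

definition local_second_stage ::
  "smoothing \<Rightarrow> ((real^'n) \<times> (real^'n0) \<Rightarrow> real) \<Rightarrow> real \<Rightarrow>
   (real^'n0 \<Rightarrow> ('n, 'n0, 'm::finite) pd_vars) \<Rightarrow> real^'n0 \<Rightarrow> real" where
  "local_second_stage sm f \<mu> w x = second_stage_value sm f \<mu> x (w x)"

definition regularity_assumption ::
  "smoothing \<Rightarrow> (real^'n0 \<Rightarrow> real) \<Rightarrow> (real^'n0 \<Rightarrow> real^'m0) \<Rightarrow>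
   ((real^'n) \<times> (real^'n0) \<Rightarrow> real) \<Rightarrow> ((real^'n) \<times> (real^'n0) \<Rightarrow> real^'m) \<Rightarrow> bool" where
  "regularity_assumption sm f0 c0 f c \<longleftrightarrow>
     C1_lipschitz_on UNIV f0 \<and> C1_lipschitz_on UNIV c0 \<and>
     (case sm of
        Objective_Smoothing \<Rightarrow> C2_lipschitz_on UNIV f \<and> C2_lipschitz_on UNIV c
      | Solution_Smoothing \<Rightarrow> C3_on UNIV f \<and> C3_on UNIV c)"

(* "solver x v0" is the point returned for the input x when started from v0.  The set X consists
   of the inputs that the first-stage problem sends to the subproblem; nothing is known about the
   solver for inputs outside X. *)

definition feasibility_assumption ::
  "((real^'n) \<times> (real^'n0) \<Rightarrow> real) \<Rightarrow> ((real^'n) \<times> (real^'n0) \<Rightarrow> real^'m) \<Rightarrow> real \<Rightarrow>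
   (real^'n0) set \<Rightarrow> (real^'n0 \<Rightarrow> ('n, 'n0, 'm) pd_vars \<Rightarrow> ('n, 'n0, 'm) pd_vars) \<Rightarrow> bool" where
  "feasibility_assumption f c \<mu> X solver \<longleftrightarrow>
     (\<forall>x\<in>X. (\<exists>y. \<forall>j. c (y, x) $ j \<le> 0) \<and> (\<forall>v0. (x, solver x v0) \<in> stationary_set f c \<mu>))"

definition consistent_output_assumption ::
  "((real^'n) \<times> (real^'n0) \<Rightarrow> real) \<Rightarrow> ((real^'n) \<times> (real^'n0) \<Rightarrow> real^'m) \<Rightarrow> real \<Rightarrow>
   ((real^'n0) \<times> ('n, 'n0, 'm) pd_vars \<Rightarrow> real) \<Rightarrow>
   (real^'n0) set \<Rightarrow> (real^'n0 \<Rightarrow> ('n, 'n0, 'm) pd_vars \<Rightarrow> ('n, 'n0, 'm) pd_vars) \<Rightarrow> bool" where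
  "consistent_output_assumption f c \<mu> r2 X solver \<longleftrightarrow>
     (\<forall>P. nondegenerate f c \<mu> P \<longrightarrow>
       (\<exists>r3>0. \<forall>xk vk d.
          xk \<in> X \<and> (\<exists>v0. vk = solver xk v0) \<and> (xk, vk) \<in> stationary_set f c \<mu> \<and>
          (xk, vk) \<in> ball P r3 \<and> xk + d \<in> X \<and> norm d \<le> r3
          \<longrightarrow> (xk + d, solver (xk + d) vk) \<in> ball P (r2 P)))"

end

theory Submission
  imports Defs
begin

text \<open>
  Write \<open>w\<close> for the local solution map at the nondegenerate point \<open>P = (xbar, vbar)\<close>.

  Parts (i) and (ii) rest on one observation: a stationary point inside \<open>ball P r2\<close> is a zero of the
  KKT map, hence lies on the graph of \<open>w\<close> (\<open>stationary_point_on_graph\<close>).  The solver output at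
  \<open>x + d\<close> falls into that ball by consistency, so it equals \<open>w (x + d)\<close>, and equal points have equal
  values.  For the uniqueness in (i) the competing map is only known to meet \<open>w\<close> at a point \<open>x\<close> near
  \<open>xbar\<close>, whereas \<open>w\<close> is characterised by its value at \<open>xbar\<close> itself.  Near \<open>xbar\<close> the set on which
  two solution maps agree is both closed and open, so agreement spreads from \<open>x\<close> to \<open>xbar\<close>
  (\<open>solution_maps_meeting_near_reference_agree\<close>), where the characterisation applies.

  Part (iii) asks for one derivative more than the solution map is known to have, and the two kinds of
  smoothing obtain it in different ways.  For objective smoothing the local function is the optimal
  value of the barrier problem, and by the envelope theorem its gradient is \<open>- eta\<close>, the negated
  multiplier of the copy constraint (\<open>objective_value_derivative\<close>); as a component of \<open>w\<close> this
  multiplier is C1.  For solution smoothing no such cancellation takes place, and \<open>w\<close> itself has to be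
  C2.  Differentiating \<open>F (x, w x) = 0\<close> gives \<open>A x o w' x = B x\<close>, where \<open>A\<close> and \<open>B\<close> are C1 because
  third derivatives of the data make \<open>F\<close> a C2 map, and where \<open>A xbar\<close> is invertible by
  nondegeneracy.  Inversion preserves the class C1 (\<open>C1_on_blinfun_inverse\<close>), so \<open>w'\<close> is C1
  (\<open>implicit_function_C2\<close>).
\<close>

section \<open>Differentiability classes\<close>

text \<open>The classes are defined by iterated derivatives in spaces of bounded linear maps.  The closure
  rules below (composition, sums, bounded bilinear products) let the regularity of a composite
  expression be read off from its syntax.  Each rule for C2 follows from that for C1, because the
  derivative of a composition or product is itself built by bilinear products.\<close>

lemma derivative_onD:
  "derivative_on U g g' \<Longrightarrow> x \<in> U \<Longrightarrow> (g has_derivative blinfun_apply (g' x)) (at x)"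
  by (simp add: derivative_on_def)

lemma derivative_on_continuous_on: "derivative_on U g g' \<Longrightarrow> continuous_on U g"
  by (intro has_derivative_continuous_on) (auto dest: derivative_onD intro: has_derivative_at_withinI)

lemma C1_on_continuous_on: "C1_on U g \<Longrightarrow> continuous_on U g"
  using derivative_on_continuous_on by (auto simp: C1_on_def)

lemma C2_on_imp_C1_on: "C2_on U g \<Longrightarrow> C1_on U g"
  using C1_on_continuous_on by (auto simp: C1_on_def C2_on_def)

lemma C3_on_imp_C2_on: "C3_on U g \<Longrightarrow> C2_on U g"
  using C2_on_imp_C1_on by (auto simp: C2_on_def C3_on_def)

lemma C2_lipschitz_on_imp_C1_on: "C2_lipschitz_on U g \<Longrightarrow> C1_on U g"
  using derivative_on_continuous_on
  by (auto simp: C1_on_def C2_lipschitz_on_def C1_lipschitz_on_def)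

lemma C1_on_subset: "C1_on U g \<Longrightarrow> V \<subseteq> U \<Longrightarrow> C1_on V g"
  by (auto simp: C1_on_def derivative_on_def intro: continuous_on_subset)

lemma C2_on_subset: "C2_on U g \<Longrightarrow> V \<subseteq> U \<Longrightarrow> C2_on V g"
  by (auto simp: C2_on_def derivative_on_def intro: C1_on_subset)

lemma C1_on_cong:
  assumes "open U" "\<And>x. x \<in> U \<Longrightarrow> g x = h x" "C1_on U h"
  shows "C1_on U g"
  using assms unfolding C1_on_def derivative_on_def
  by (metis has_derivative_transform_within_open)

lemma C1_on_const: "C1_on U (\<lambda>x. k)"
  unfolding C1_on_def derivative_on_def
  by (intro exI[of _ "\<lambda>_. 0"]) (auto simp: zero_blinfun.rep_eq)

lemma C2_on_const: "C2_on U (\<lambda>x. k)"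
  unfolding C2_on_def derivative_on_def
  by (intro exI[of _ "\<lambda>_. 0"]) (auto simp: zero_blinfun.rep_eq C1_on_const)

lemma bounded_linear_derivative_on: "bounded_linear l \<Longrightarrow> derivative_on U l (\<lambda>_. Blinfun l)"
  by (simp add: derivative_on_def bounded_linear_Blinfun_apply bounded_linear_imp_has_derivative)

lemma bounded_linear_C1_on: "bounded_linear l \<Longrightarrow> C1_on U l"
  unfolding C1_on_def by (blast intro: bounded_linear_derivative_on continuous_on_const)

lemma bounded_linear_C2_on: "bounded_linear l \<Longrightarrow> C2_on U l"
  unfolding C2_on_def by (blast intro: bounded_linear_derivative_on C1_on_const)

lemma derivative_on_compose:
  assumes "derivative_on V h h'" "derivative_on U g g'" "g ` U \<subseteq> V"
  shows "derivative_on U (\<lambda>x. h (g x)) (\<lambda>x. h' (g x) o\<^sub>L g' x)"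
  unfolding derivative_on_def
proof
  fix x assume "x \<in> U"
  then have "(g has_derivative g' x) (at x)" "(h has_derivative h' (g x)) (at (g x))"
    using assms by (auto dest: derivative_onD)
  from has_derivative_compose[OF this]
  show "((\<lambda>x. h (g x)) has_derivative blinfun_apply (h' (g x) o\<^sub>L g' x)) (at x)"
    by (simp add: has_derivative_eq_rhs fun_eq_iff)
qed

lemma derivative_on_add:
  assumes "derivative_on U g g'" "derivative_on U h h'"
  shows "derivative_on U (\<lambda>x. g x + h x) (\<lambda>x. g' x + h' x)"
  using assms unfolding derivative_on_def
  by (auto intro!: derivative_eq_intros simp: plus_blinfun.rep_eq)

lemma (in bounded_bilinear) derivative_on_prod:
  assumes "derivative_on U g g'" "derivative_on U h h'"
  shows "derivative_on U (\<lambda>x. prod (g x) (h x))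
           (\<lambda>x. (prod_right (g x) o\<^sub>L h' x) + (prod_left (h x) o\<^sub>L g' x))"
  unfolding derivative_on_def
proof
  fix x assume "x \<in> U"
  then have "(g has_derivative g' x) (at x)" "(h has_derivative h' x) (at x)"
    using assms by (auto dest: derivative_onD)
  from FDERIV[OF this]
  show "((\<lambda>x. prod (g x) (h x)) has_derivative
    blinfun_apply ((prod_right (g x) o\<^sub>L h' x) + (prod_left (h x) o\<^sub>L g' x))) (at x)"
    by (rule has_derivative_eq_rhs) (simp add: plus_blinfun.rep_eq fun_eq_iff)
qed

lemma C1_on_compose:
  assumes "C1_on V h" "C1_on U g" "g ` U \<subseteq> V"
  shows "C1_on U (\<lambda>x. h (g x))"
proof -
  obtain g' h' where g: "derivative_on U g g'" "continuous_on U g'"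
    and h: "derivative_on V h h'" "continuous_on V h'"
    using assms by (auto simp: C1_on_def)
  have "continuous_on U (\<lambda>x. h' (g x))"
    by (rule continuous_on_compose2[OF h(2) derivative_on_continuous_on[OF g(1)] assms(3)])
  with g(2) have "continuous_on U (\<lambda>x. h' (g x) o\<^sub>L g' x)"
    by (rule bounded_bilinear.continuous_on[OF bounded_bilinear_blinfun_compose, rotated])
  with derivative_on_compose[OF h(1) g(1) assms(3)] show ?thesis
    by (auto simp: C1_on_def)
qed

lemma C1_on_add:
  assumes "C1_on U g" "C1_on U h"
  shows "C1_on U (\<lambda>x. g x + h x)"
  using assms unfolding C1_on_def by (blast intro: derivative_on_add continuous_on_add)

lemma C1_on_linear:
  assumes "bounded_linear l" "C1_on U g"
  shows "C1_on U (\<lambda>x. l (g x))"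
  using C1_on_compose[OF bounded_linear_C1_on[OF assms(1), of UNIV] assms(2)] by simp

lemma (in bounded_bilinear) C1_on_prod:
  assumes "C1_on U g" "C1_on U h"
  shows "C1_on U (\<lambda>x. prod (g x) (h x))"
proof -
  obtain g' h' where g: "derivative_on U g g'" "continuous_on U g'"
    and h: "derivative_on U h h'" "continuous_on U h'"
    using assms by (auto simp: C1_on_def)
  note cont = g(2) h(2) derivative_on_continuous_on[OF g(1)] derivative_on_continuous_on[OF h(1)]
  have "continuous_on U (\<lambda>x. (prod_right (g x) o\<^sub>L h' x) + (prod_left (h x) o\<^sub>L g' x))"
    by (intro continuous_on_add
        bounded_bilinear.continuous_on[OF bounded_bilinear_blinfun_compose]
        bounded_linear.continuous_on[OF bounded_linear_prod_left]
        bounded_linear.continuous_on[OF bounded_linear_prod_right] cont)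
  with derivative_on_prod[OF g(1) h(1)] show ?thesis
    by (auto simp: C1_on_def)
qed

lemmas C1_on_blinfun_compose = bounded_bilinear.C1_on_prod[OF bounded_bilinear_blinfun_compose]

lemma C2_on_compose:
  assumes "C2_on V h" "C2_on U g" "g ` U \<subseteq> V"
  shows "C2_on U (\<lambda>x. h (g x))"
proof -
  obtain g' h' where g: "derivative_on U g g'" "C1_on U g'"
    and h: "derivative_on V h h'" "C1_on V h'"
    using assms by (auto simp: C2_on_def)
  have "C1_on U (\<lambda>x. h' (g x) o\<^sub>L g' x)"
    by (intro C1_on_blinfun_compose C1_on_compose[OF h(2) _ assms(3)] C2_on_imp_C1_on assms g)
  with derivative_on_compose[OF h(1) g(1) assms(3)] show ?thesis
    by (auto simp: C2_on_def)
qed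

lemma C2_on_add:
  assumes "C2_on U g" "C2_on U h"
  shows "C2_on U (\<lambda>x. g x + h x)"
  using assms unfolding C2_on_def by (blast intro: derivative_on_add C1_on_add)

lemma C2_on_linear:
  assumes "bounded_linear l" "C2_on U g"
  shows "C2_on U (\<lambda>x. l (g x))"
  using C2_on_compose[OF bounded_linear_C2_on[OF assms(1), of UNIV] assms(2)] by simp

lemma (in bounded_bilinear) C2_on_prod:
  assumes "C2_on U g" "C2_on U h"
  shows "C2_on U (\<lambda>x. prod (g x) (h x))"
proof -
  obtain g' h' where g: "derivative_on U g g'" "C1_on U g'"
    and h: "derivative_on U h h'" "C1_on U h'"
    using assms by (auto simp: C2_on_def)
  have "C1_on U (\<lambda>x. (prod_right (g x) o\<^sub>L h' x) + (prod_left (h x) o\<^sub>L g' x))"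
    by (intro C1_on_add C1_on_blinfun_compose C1_on_linear[OF bounded_linear_prod_left]
        C1_on_linear[OF bounded_linear_prod_right] C2_on_imp_C1_on assms g h)
  with derivative_on_prod[OF g(1) h(1)] show ?thesis
    by (auto simp: C2_on_def)
qed

lemma bounded_linear_inl: "bounded_linear (\<lambda>a::'a::real_normed_vector. (a, 0::'b::real_normed_vector))"
  by (intro bounded_linear_Pair bounded_linear_ident bounded_linear_zero)

lemma bounded_linear_inr: "bounded_linear (\<lambda>b::'b::real_normed_vector. (0::'a::real_normed_vector, b))"
  by (intro bounded_linear_Pair bounded_linear_ident bounded_linear_zero)

lemma C1_on_Pair:
  assumes "C1_on U g" "C1_on U h"
  shows "C1_on U (\<lambda>x. (g x, h x))"
  using C1_on_add[OF C1_on_linear[OF bounded_linear_inl assms(1)]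
    C1_on_linear[OF bounded_linear_inr assms(2)]] by simp

lemma C2_on_Pair:
  assumes "C2_on U g" "C2_on U h"
  shows "C2_on U (\<lambda>x. (g x, h x))"
  using C2_on_add[OF C2_on_linear[OF bounded_linear_inl assms(1)]
    C2_on_linear[OF bounded_linear_inr assms(2)]] by simp

section \<open>Inverting a differentiable family of linear maps\<close>

lemma inj_blinfun_inverse:
  fixes A :: "'e::euclidean_space \<Rightarrow>\<^sub>L 'e"
  assumes "inj (blinfun_apply A)"
  obtains L where "L o\<^sub>L A = id_blinfun" "A o\<^sub>L L = id_blinfun"
proof -
  have lin: "linear (blinfun_apply A)"
    using blinfun.bounded_linear_right bounded_linear.linear by blast
  obtain l where l: "linear l" "\<forall>x. l (A x) = x" "\<forall>x. A (l x) = x"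
    using linear_injective_isomorphism[OF lin assms] by blast
  then have "blinfun_apply (Blinfun l) = l"
    by (simp add: bounded_linear_Blinfun_apply linear_conv_bounded_linear)
  with l have "Blinfun l o\<^sub>L A = id_blinfun" "A o\<^sub>L Blinfun l = id_blinfun"
    by (auto intro!: blinfun_eqI)
  then show ?thesis by (rule that)
qed

text \<open>The operator form of \<open>1/a - 1/b = (b - a)/(a b)\<close>.  It reduces continuity and differentiability of
  the inverse to those of the map that is inverted.\<close>

lemma blinfun_inverse_diff:
  assumes "L o\<^sub>L A = id_blinfun" "B o\<^sub>L M = id_blinfun"
  shows "L - M = L o\<^sub>L (B - A) o\<^sub>L M"
proof (rule blinfun_eqI)
  fix u
  have "L (A (M u)) = M u" "B (M u) = u"
    using assms by (metis blinfun_apply_blinfun_compose blinfun_apply_id_blinfun)+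
  then show "(L - M) u = (L o\<^sub>L (B - A) o\<^sub>L M) u"
    by (simp add: blinfun.diff_left blinfun.diff_right)
qed

text \<open>With \<open>K\<close> the inverse of \<open>A x0\<close>, the product \<open>K o A x\<close> stays within \<open>1/2\<close> of the identity for \<open>x\<close>
  near \<open>x0\<close>.  So \<open>A x\<close> is bounded below uniformly in \<open>x\<close>, which makes it injective, hence invertible
  in finite dimension, and bounds all the inverses at once.\<close>

lemma blinfun_inverse_near_bounded:
  fixes A :: "'x::real_normed_vector \<Rightarrow> 'e::euclidean_space \<Rightarrow>\<^sub>L 'e"
  assumes U: "open U" "x0 \<in> U" and cont: "continuous_on U A" and inj: "inj (blinfun_apply (A x0))"
  obtains \<delta> M L where "0 < \<delta>" "ball x0 \<delta> \<subseteq> U"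
    "\<And>x. x \<in> ball x0 \<delta> \<Longrightarrow> L x o\<^sub>L A x = id_blinfun"
    "\<And>x. x \<in> ball x0 \<delta> \<Longrightarrow> A x o\<^sub>L L x = id_blinfun"
    "\<And>x. x \<in> ball x0 \<delta> \<Longrightarrow> norm (L x) \<le> M"
proof -
  obtain K where K: "K o\<^sub>L A x0 = id_blinfun"
    using inj_blinfun_inverse[OF inj] by blast
  \<comment> \<open>If \<open>A x\<close> is \<open>e\<close>-close to \<open>A x0\<close>, then \<open>norm (v - K (A x v)) \<le> norm v / 2\<close> for all \<open>v\<close>.\<close>
  define e where "e = 1 / (2 * (norm K + 1))"
  have e: "e > 0" "norm K * e \<le> 1/2"
    by (auto simp: e_def field_simps add_nonneg_pos add_pos_nonneg)
  have "isCont A x0"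
    using cont U by (simp add: continuous_on_eq_continuous_at)
  then obtain d where d: "d > 0" "\<And>x. dist x x0 < d \<Longrightarrow> dist (A x) (A x0) < e"
    using e(1) unfolding continuous_at_eps_delta by blast
  obtain d' where d': "d' > 0" "ball x0 d' \<subseteq> U"
    using U open_contains_ball by blast
  define \<delta> where "\<delta> = min d d'"
  have bound: "norm v \<le> 2 * norm K * norm (A x v)" if "x \<in> ball x0 \<delta>" for x v
  proof -
    have lt: "norm (A x0 - A x) \<le> e"
      using that d(2)[of x] by (simp add: \<delta>_def dist_norm norm_minus_commute)
    have "v = K (A x0 v)"
      using K by (metis blinfun_apply_blinfun_compose blinfun_apply_id_blinfun)
    also have "\<dots> = K (A x v) + K ((A x0 - A x) v)"
      by (simp add: blinfun.diff_left blinfun.diff_right)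
    finally have "norm v \<le> norm (K (A x v)) + norm (K ((A x0 - A x) v))"
      by (metis norm_triangle_ineq)
    also have "norm (K (A x v)) \<le> norm K * norm (A x v)"
      by (rule norm_blinfun)
    also have "norm (K ((A x0 - A x) v)) \<le> norm K * (e * norm v)"
      by (intro order_trans[OF norm_blinfun] mult_left_mono order_trans[OF norm_blinfun]
          mult_right_mono lt) auto
    also have "norm K * (e * norm v) \<le> 1/2 * norm v"
      using mult_right_mono[OF e(2), of "norm v"] by (simp add: mult.assoc)
    finally show ?thesis by simp
  qed
  have "\<exists>L. L o\<^sub>L A x = id_blinfun \<and> A x o\<^sub>L L = id_blinfun \<and> norm L \<le> 2 * norm K"
    if x: "x \<in> ball x0 \<delta>" for x
  proof -
    have "inj (blinfun_apply (A x))"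
    proof (rule injI)
      fix a b assume "A x a = A x b"
      then have "A x (a - b) = 0"
        by (simp add: blinfun.diff_right)
      then show "a = b"
        using bound[OF x, of "a - b"] by simp
    qed
    then obtain L where L: "L o\<^sub>L A x = id_blinfun" "A x o\<^sub>L L = id_blinfun"
      using inj_blinfun_inverse by blast
    moreover have "norm L \<le> 2 * norm K"
    proof (rule norm_blinfun_bound)
      fix u
      have "A x (L u) = u"
        using L(2) by (metis blinfun_apply_blinfun_compose blinfun_apply_id_blinfun)
      then show "norm (L u) \<le> 2 * norm K * norm u"
        using bound[OF x, of "L u"] by simp
    qed simp
    ultimately show ?thesis by blast
  qed
  then obtain L where "\<And>x. x \<in> ball x0 \<delta> \<Longrightarrow>
      L x o\<^sub>L A x = id_blinfun \<and> A x o\<^sub>L L x = id_blinfun \<and> norm (L x) \<le> 2 * norm K"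
    by metis
  then show ?thesis
    using that[of \<delta> L "2 * norm K"] d(1) d' by (simp add: \<delta>_def subset_eq)
qed

text \<open>A product rule for a first factor that is merely continuous: where the second factor vanishes, the
  term containing the derivative of the first one drops out, and
  \<open>prod (g y - g x) (h y)\<close> is of smaller order than \<open>y - x\<close>.\<close>

lemma (in bounded_bilinear) has_derivative_prod_vanishing:
  assumes g: "isCont g x" and h: "(h has_derivative h') (at x)" and "h x = 0"
  shows "((\<lambda>y. prod (g y) (h y)) has_derivative (\<lambda>d. prod (g x) (h' d))) (at x)"
proof -
  obtain C where C: "\<And>d. norm (h' d) \<le> norm d * C"
    using bounded_linear.bounded[OF has_derivative_bounded_linear[OF h]] by blast
  have "((\<lambda>y. (h y - h x - h' (y - x)) /\<^sub>R norm (y - x)) \<longlongrightarrow> 0) (at x)"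
    using h by (simp add: has_derivative_at_within)
  then have "\<forall>\<^sub>F y in at x. norm ((h y - h x - h' (y - x)) /\<^sub>R norm (y - x)) < 1"
    by (rule order_tendstoD(2)[OF tendsto_norm_zero]) simp
  then have "\<forall>\<^sub>F y in at x. norm (h y /\<^sub>R norm (y - x)) \<le> 1 + C"
    using eventually_neq_at_within[of x x UNIV]
  proof eventually_elim
    case (elim y)
    have "norm (h y) \<le> norm (h y - h x - h' (y - x)) + norm (h' (y - x))"
      using \<open>h x = 0\<close> norm_triangle_sub[of "h y" "h' (y - x)"] by simp
    also have "norm (h y - h x - h' (y - x)) \<le> norm (y - x)"
      using elim unfolding norm_scaleR by (simp add: divide_simps)
    also have "norm (h' (y - x)) \<le> norm (y - x) * C"
      by (rule C)
    finally show ?case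
      using elim by (simp add: field_simps)
  qed
  then have "Bfun (\<lambda>y. h y /\<^sub>R norm (y - x)) (at x)"
    by (rule BfunI)
  moreover have "Zfun (\<lambda>y. g y - g x) (at x)"
    using g by (simp add: isCont_def tendsto_Zfun_iff)
  ultimately have "Zfun (\<lambda>y. prod (g y - g x) (h y /\<^sub>R norm (y - x))) (at x)"
    by (rule Zfun_prod_Bfun[rotated])
  then have "((\<lambda>y. prod (g y - g x) (h y)) has_derivative (\<lambda>_. 0)) (at x)"
    using \<open>h x = 0\<close> by (simp add: has_derivative_at_within tendsto_Zfun_iff scaleR_right zero_right)
  from has_derivative_add[OF bounded_linear.has_derivative[OF bounded_linear_right h, of "g x"] this]
  show ?thesis by (simp add: diff_left)
qed

text \<open>In \<open>L y = L x - L y o (A y - A x) o L x\<close> the unknown \<open>L y\<close> occurs on the right only next to a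
  factor that vanishes at \<open>y = x\<close>.  So the uniform bound on \<open>L\<close> yields its continuity, and continuity
  already yields the derivative \<open>d \<mapsto> - L x o A' x d o L x\<close>, which is continuous in turn.\<close>

lemma C1_on_blinfun_inverse:
  fixes A :: "'x::real_normed_vector \<Rightarrow> 'e::euclidean_space \<Rightarrow>\<^sub>L 'e"
  assumes U: "open U" "x0 \<in> U" and A: "C1_on U A" and inj: "inj (blinfun_apply (A x0))"
  obtains \<delta> L where "0 < \<delta>" "ball x0 \<delta> \<subseteq> U" "C1_on (ball x0 \<delta>) L"
    "\<And>x. x \<in> ball x0 \<delta> \<Longrightarrow> L x o\<^sub>L A x = id_blinfun"
proof -
  obtain \<delta> M L where \<delta>: "0 < \<delta>" and sub: "ball x0 \<delta> \<subseteq> U"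
    and left: "\<And>x. x \<in> ball x0 \<delta> \<Longrightarrow> L x o\<^sub>L A x = id_blinfun"
    and right: "\<And>x. x \<in> ball x0 \<delta> \<Longrightarrow> A x o\<^sub>L L x = id_blinfun"
    and bound: "\<And>x. x \<in> ball x0 \<delta> \<Longrightarrow> norm (L x) \<le> M"
    using blinfun_inverse_near_bounded[OF U C1_on_continuous_on[OF A] inj] by metis
  let ?B = "ball x0 \<delta>"
  obtain A' where A': "derivative_on U A A'" "continuous_on U A'"
    using A by (auto simp: C1_on_def)
  have diff: "L y = L x - (L y o\<^sub>L (A y - A x) o\<^sub>L L x)" if "x \<in> ?B" "y \<in> ?B" for x y
    using blinfun_inverse_diff[OF left[OF that(2)] right[OF that(1)]]
    by (simp add: algebra_simps bounded_bilinear.diff_left[OF bounded_bilinear_blinfun_compose]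
        bounded_bilinear.diff_right[OF bounded_bilinear_blinfun_compose])
  have M: "0 \<le> M"
    using bound[of x0] \<delta> order_trans[OF norm_ge_zero] by auto
  have L_cont: "isCont L x" if x: "x \<in> ?B" for x
  proof -
    have "isCont A x"
      using derivative_on_continuous_on[OF A'(1)] U(1) sub x
      by (auto simp: continuous_on_eq_continuous_at)
    then have "((\<lambda>y. M * norm (A y - A x) * M) \<longlongrightarrow> 0) (at x)"
      unfolding isCont_def by (auto intro!: tendsto_eq_intros)
    moreover have "\<forall>\<^sub>F y in at x. norm (L y - L x) \<le> M * norm (A y - A x) * M"
    proof (rule eventually_at_in_open'[THEN eventually_mono])
      fix y assume y: "y \<in> ?B"
      have "L y - L x = - (L y o\<^sub>L (A y - A x) o\<^sub>L L x)"
        using diff[OF x y] by (metis diff_minus_eq_add uminus_add_conv_diff add_diff_cancel_left')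
      then have "norm (L y - L x) = norm (L y o\<^sub>L (A y - A x) o\<^sub>L L x)"
        by simp
      also have "\<dots> \<le> (norm (L y) * norm (A y - A x)) * norm (L x)"
        by (intro order_trans[OF norm_blinfun_compose] mult_right_mono norm_blinfun_compose) simp
      also have "\<dots> \<le> M * norm (A y - A x) * M"
        using bound[OF x] bound[OF y] M by (intro mult_mono) auto
      finally show "norm (L y - L x) \<le> M * norm (A y - A x) * M" .
    qed (use x in auto)
    ultimately have "((\<lambda>y. L y - L x) \<longlongrightarrow> 0) (at x)"
      by (rule Lim_null_comparison[rotated])
    then show ?thesis
      by (simp add: isCont_def LIM_zero_iff)
  qed
  interpret comp: bounded_bilinear "(o\<^sub>L) :: ('e \<Rightarrow>\<^sub>L 'e) \<Rightarrow> ('e \<Rightarrow>\<^sub>L 'e) \<Rightarrow> ('e \<Rightarrow>\<^sub>L 'e)"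
    by (rule bounded_bilinear_blinfun_compose)
  define L' where "L' x = - (comp.prod_left (L x) o\<^sub>L (comp.prod_right (L x) o\<^sub>L A' x))" for x
  have L'_apply: "L' x d = - (L x o\<^sub>L A' x d o\<^sub>L L x)" for x d
    by (simp add: L'_def uminus_blinfun.rep_eq)
  have "derivative_on ?B L L'"
    unfolding derivative_on_def
  proof
    fix x assume x: "x \<in> ?B"
    have "((\<lambda>y. A y - A x) has_derivative A' x) (at x)"
      using derivative_onD[OF A'(1)] sub x by (auto intro!: derivative_eq_intros)
    from comp.has_derivative_prod_vanishing[OF L_cont[OF x] this]
    have "((\<lambda>y. L y o\<^sub>L (A y - A x)) has_derivative (\<lambda>d. L x o\<^sub>L A' x d)) (at x)"
      by simp
    from bounded_linear.has_derivative[OF comp.bounded_linear_left this, of "L x"]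
    have "((\<lambda>y. L x - (L y o\<^sub>L (A y - A x) o\<^sub>L L x)) has_derivative L' x) (at x)"
      by (rule has_derivative_eq_rhs[OF has_derivative_diff[OF has_derivative_const]])
        (simp add: L'_apply fun_eq_iff)
    then show "(L has_derivative L' x) (at x)"
      by (rule has_derivative_transform_within_open[OF _ open_ball x]) (use diff x in simp)
  qed
  moreover have "continuous_on ?B L'"
    unfolding L'_def
    using L_cont continuous_on_subset[OF A'(2) sub]
    by (intro continuous_on_minus bounded_bilinear.continuous_on[OF bounded_bilinear_blinfun_compose]
        bounded_linear.continuous_on[OF comp.bounded_linear_prod_left]
        bounded_linear.continuous_on[OF comp.bounded_linear_prod_right])
      (simp_all add: continuous_on_eq_continuous_at)
  ultimately have "C1_on ?B L"
    by (auto simp: C1_on_def)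
  with that \<delta> sub left show ?thesis by blast
qed

text \<open>A C1 function that solves an equation implicitly inherits the regularity of the equation: the
  chain rule expresses its derivative by first derivatives of \<open>F\<close> along the graph, which are C1.\<close>

lemma implicit_function_C2:
  fixes F :: "'x::real_normed_vector \<times> 'e::euclidean_space \<Rightarrow> 'e"
  assumes F: "C2_on UNIV F" and w: "C1_on U w" and U: "open U" "x0 \<in> U"
    and zero: "\<And>x. x \<in> U \<Longrightarrow> F (x, w x) = 0"
    and D: "((\<lambda>v. F (x0, v)) has_derivative D) (at (w x0))" "inj D"
  obtains \<delta> where "0 < \<delta>" "ball x0 \<delta> \<subseteq> U" "C2_on (ball x0 \<delta>) w"
proof -
  obtain F' where F': "derivative_on UNIV F F'" "C1_on UNIV F'"
    using F by (auto simp: C2_on_def)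
  obtain w' where w': "derivative_on U w w'"
    using w by (auto simp: C1_on_def)
  define inl where "inl = Blinfun (\<lambda>a. (a::'x, 0::'e))"
  define inr where "inr = Blinfun (\<lambda>b. (0::'x, b::'e))"
  have inl [simp]: "blinfun_apply inl = (\<lambda>a. (a, 0))" and inr [simp]: "blinfun_apply inr = (\<lambda>b. (0, b))"
    by (simp_all add: inl_def inr_def bounded_linear_Blinfun_apply bounded_linear_inl bounded_linear_inr)
  \<comment> \<open>\<open>A\<close> is the partial derivative in \<open>v\<close>, and \<open>B\<close> is minus the partial derivative in \<open>x\<close>.\<close>
  define A where "A x = F' (x, w x) o\<^sub>L inr" for x
  define B where "B x = - (F' (x, w x) o\<^sub>L inl)" for x
  have F'w: "C1_on U (\<lambda>x. F' (x, w x))"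
    by (intro C1_on_compose[OF F'(2)] C1_on_Pair w bounded_linear_C1_on bounded_linear_ident) simp
  have A: "C1_on U A" and B: "C1_on U B"
    unfolding A_def B_def
    by (intro C1_on_linear[OF bounded_linear_minus[OF bounded_linear_ident]]
        C1_on_blinfun_compose C1_on_const F'w)+
  have dF: "(F has_derivative F' p) (at p)" for p
    using derivative_onD[OF F'(1)] by simp
  have eq: "A x o\<^sub>L w' x = B x" if x: "x \<in> U" for x
  proof (rule blinfun_eqI)
    fix d
    have "((\<lambda>x. (x, w x)) has_derivative (\<lambda>d. (d, w' x d))) (at x)"
      by (intro has_derivative_Pair has_derivative_ident derivative_onD[OF w' x])
    from has_derivative_compose[OF this dF]
    have "((\<lambda>x. F (x, w x)) has_derivative (\<lambda>d. F' (x, w x) (d, w' x d))) (at x)" .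
    moreover have "((\<lambda>x. F (x, w x)) has_derivative (\<lambda>_. 0)) (at x)"
      by (rule has_derivative_transform_within_open[OF has_derivative_const U(1) x]) (simp add: zero)
    ultimately have "F' (x, w x) (d, w' x d) = 0"
      using has_derivative_unique by (metis (no_types))
    moreover have "(d, w' x d) = (d, 0) + (0, w' x d)" by simp
    ultimately show "(A x o\<^sub>L w' x) d = B x d"
      by (simp only: A_def B_def blinfun_apply_blinfun_compose inl inr uminus_blinfun.rep_eq
          blinfun.add_right) (metis add.commute add_eq_0_iff)
  qed
  have "((\<lambda>v. F (x0, v)) has_derivative A x0) (at (w x0))"
    using has_derivative_compose[OF has_derivative_Pair[OF has_derivative_const has_derivative_ident] dF]
    by (rule has_derivative_eq_rhs) (simp add: A_def fun_eq_iff)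
  then have "inj (blinfun_apply (A x0))"
    using D has_derivative_unique by blast
  from C1_on_blinfun_inverse[OF U A this]
  obtain \<delta> L where \<delta>: "0 < \<delta>" "ball x0 \<delta> \<subseteq> U" "C1_on (ball x0 \<delta>) L"
    and L: "\<And>x. x \<in> ball x0 \<delta> \<Longrightarrow> L x o\<^sub>L A x = id_blinfun" by blast
  have "w' x = L x o\<^sub>L B x" if "x \<in> ball x0 \<delta>" for x
  proof (rule blinfun_eqI)
    fix d
    have "L x (A x (w' x d)) = w' x d"
      using L[OF that] by (metis blinfun_apply_blinfun_compose blinfun_apply_id_blinfun)
    moreover have "A x (w' x d) = B x d"
      using eq that \<delta>(2) by (metis blinfun_apply_blinfun_compose subsetD)
    ultimately show "w' x d = (L x o\<^sub>L B x) d" by simp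
  qed
  then have "C1_on (ball x0 \<delta>) w'"
    by (rule C1_on_cong[OF open_ball])
      (use \<delta> B in \<open>auto intro: C1_on_blinfun_compose C1_on_subset\<close>)
  moreover have "derivative_on (ball x0 \<delta>) w w'"
    using w' \<delta>(2) by (auto simp: derivative_on_def)
  ultimately have "C2_on (ball x0 \<delta>) w"
    by (auto simp: C2_on_def)
  with that \<delta> show ?thesis by blast
qed


section \<open>Optimality system\<close>

definition riesz :: "('a::euclidean_space \<Rightarrow>\<^sub>L real) \<Rightarrow> 'a" where
  "riesz g = (\<Sum>b\<in>Basis. g b *\<^sub>R b)"

lemma inner_riesz: "h \<bullet> riesz g = g h"
proof -
  have "h \<bullet> riesz g = (\<Sum>b\<in>Basis. (h \<bullet> b) *\<^sub>R g b)"
    by (simp add: riesz_def inner_sum_right mult.commute)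
  also have "\<dots> = g (\<Sum>b\<in>Basis. (h \<bullet> b) *\<^sub>R b)"
    by (simp add: blinfun.sum_right blinfun.scaleR_right)
  finally show ?thesis by (simp add: euclidean_representation)
qed

lemma bounded_linear_riesz: "bounded_linear riesz"
  unfolding riesz_def
  by (intro bounded_linear_sum bounded_linear_compose[OF bounded_linear_scaleR_left] blinfun.bounded_linear_left)

lemma grad_eqI:
  assumes "(g has_derivative (\<lambda>h. h \<bullet> D)) (at x)"
  shows "grad g x = D"
  unfolding grad_def
proof (rule the_equality)
  show "GDERIV g x :> D"
    using assms by (simp add: gderiv_def)
  fix D' assume "GDERIV g x :> D'"
  then have "(\<lambda>h. h \<bullet> D') = (\<lambda>h. h \<bullet> D)"
    using assms has_derivative_unique by (auto simp: gderiv_def)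
  then show "D' = D"
    by (metis inner_commute vector_eq_ldot)
qed

text \<open>The gradient at \<open>p\<close> of \<open>f + c \<bullet> lam\<close>.  With \<open>p = (y, xt)\<close> its two blocks are the gradients that
  enter the KKT map, up to the multiplier of the copy constraint in the second one.\<close>

definition coupled_gradient ::
  "('a::euclidean_space \<Rightarrow> 'a \<Rightarrow>\<^sub>L real) \<Rightarrow> ('a \<Rightarrow> 'a \<Rightarrow>\<^sub>L 'm::euclidean_space) \<Rightarrow> 'a \<Rightarrow> 'm \<Rightarrow> 'a" where
  "coupled_gradient f' c' p lam = riesz (f' p + (blinfun_inner_right lam o\<^sub>L c' p))"

lemma inner_coupled_gradient: "h \<bullet> coupled_gradient f' c' p lam = f' p h + lam \<bullet> c' p h"
  by (simp add: coupled_gradient_def inner_riesz plus_blinfun.rep_eq blinfun_inner_right.rep_eq)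

text \<open>The implicitly chosen gradients in the KKT map are replaced by an explicit expression in the
  derivatives of the data, to which the closure rules for C2 apply.\<close>

lemma kkt_map_eq:
  assumes f: "derivative_on UNIV f f'" and c: "derivative_on UNIV c c'"
  shows "kkt_map f c \<mu> (y, xt, s, lam, eta) x =
    (fst (coupled_gradient f' c' (y, xt) lam),
     snd (coupled_gradient f' c' (y, xt) lam) + eta,
     (\<chi> j. s $ j * lam $ j) - (\<chi> j. \<mu>), c (y, xt) + s, xt - x)"
proof -
  let ?G = "coupled_gradient f' c' (y, xt) lam"
  have df: "(f has_derivative f' p) (at p)" and dc: "(c has_derivative c' p) (at p)" for p
    using f c by (auto dest: derivative_onD)
  have "((\<lambda>y'. (y', xt)) has_derivative (\<lambda>h. (h, 0))) (at y)"
    by (intro has_derivative_Pair has_derivative_ident has_derivative_const)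
  note y = has_derivative_compose[OF this df] has_derivative_compose[OF this dc]
  have "((\<lambda>xt'. (y, xt')) has_derivative (\<lambda>h. (0, h))) (at xt)"
    by (intro has_derivative_Pair has_derivative_ident has_derivative_const)
  note xt = has_derivative_compose[OF this df] has_derivative_compose[OF this dc]
  have "grad (\<lambda>y'. lagrangian f c x (y', xt, s, lam, eta)) y = fst ?G"
  proof (rule grad_eqI)
    have "h \<bullet> fst ?G = f' (y, xt) (h, 0) + lam \<bullet> c' (y, xt) (h, 0)" for h
      using inner_coupled_gradient[of "(h, 0)" f' c' "(y, xt)" lam] by (simp add: inner_prod_def)
    with y show "((\<lambda>y'. lagrangian f c x (y', xt, s, lam, eta)) has_derivative (\<lambda>h. h \<bullet> fst ?G)) (at y)"
      by (auto simp: lagrangian_def inner_commute intro!: derivative_eq_intros)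
  qed
  moreover have "grad (\<lambda>xt'. lagrangian f c x (y, xt', s, lam, eta)) xt = snd ?G + eta"
  proof (rule grad_eqI)
    have "h \<bullet> snd ?G = f' (y, xt) (0, h) + lam \<bullet> c' (y, xt) (0, h)" for h
      using inner_coupled_gradient[of "(0, h)" f' c' "(y, xt)" lam] by (simp add: inner_prod_def)
    with xt show "((\<lambda>xt'. lagrangian f c x (y, xt', s, lam, eta)) has_derivative (\<lambda>h. h \<bullet> (snd ?G + eta))) (at xt)"
      by (auto simp: lagrangian_def inner_commute inner_add_right intro!: derivative_eq_intros)
  qed
  ultimately show ?thesis
    by (simp add: kkt_map_def vec_eq_iff)
qed

lemma stationary_setD:
  assumes f: "derivative_on UNIV f f'" and c: "derivative_on UNIV c c'"
    and S: "(x, (y, xt, s, lam, eta)) \<in> stationary_set f c \<mu>"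
  shows "xt = x" "s = - c (y, x)" "coupled_gradient f' c' (y, x) lam = (0, - eta)"
    "\<And>j. 0 < s $ j" "\<And>j. s $ j * lam $ j = \<mu>"
proof -
  have *: "kkt_map f c \<mu> (y, xt, s, lam, eta) x = 0" and "\<And>j. 0 < s $ j"
    using S by (auto simp: stationary_set_def)
  then show "xt = x" "\<And>j. 0 < s $ j" "\<And>j. s $ j * lam $ j = \<mu>"
    unfolding kkt_map_eq[OF f c] by (auto simp: prod_eq_iff vec_eq_iff)
  with * show "s = - c (y, x)" "coupled_gradient f' c' (y, x) lam = (0, - eta)"
    unfolding kkt_map_eq[OF f c]
    by (auto simp: prod_eq_iff eq_neg_iff_add_eq_0 add.commute)
qed

lemma bounded_bilinear_componentwise_times:
  "bounded_bilinear (\<lambda>a b :: real^'m. \<chi> j. a $ j * b $ j)"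
  unfolding bilinear_conv_bounded_bilinear[symmetric] bilinear_def
  by (auto intro!: linearI simp: vec_eq_iff algebra_simps)

lemma kkt_map_C2:
  fixes f :: "(real^'n) \<times> (real^'n0) \<Rightarrow> real" and c :: "(real^'n) \<times> (real^'n0) \<Rightarrow> real^'m"
  assumes "C3_on UNIV f" "C3_on UNIV c"
  shows "C2_on UNIV (\<lambda>p. kkt_map f c \<mu> (snd p) (fst p))"
proof -
  obtain f' c' where f: "derivative_on UNIV f f'" "C2_on UNIV f'"
    and c: "derivative_on UNIV c c'" "C2_on UNIV c'"
    using assms by (auto simp: C3_on_def)
  let ?y = "\<lambda>p :: (real^'n0) \<times> ('n, 'n0, 'm) pd_vars. fst (snd p)"
  let ?xt = "\<lambda>p :: (real^'n0) \<times> ('n, 'n0, 'm) pd_vars. fst (snd (snd p))"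
  let ?s = "\<lambda>p :: (real^'n0) \<times> ('n, 'n0, 'm) pd_vars. fst (snd (snd (snd p)))"
  let ?lam = "\<lambda>p :: (real^'n0) \<times> ('n, 'n0, 'm) pd_vars. fst (snd (snd (snd (snd p))))"
  let ?eta = "\<lambda>p :: (real^'n0) \<times> ('n, 'n0, 'm) pd_vars. snd (snd (snd (snd (snd p))))"
  let ?G = "\<lambda>p. coupled_gradient f' c' (?y p, ?xt p) (?lam p)"
  note proj = C2_on_linear[OF bounded_linear_fst] C2_on_linear[OF bounded_linear_snd]
    bounded_linear_C2_on[OF bounded_linear_ident]
  have yxt: "C2_on UNIV (\<lambda>p. (?y p, ?xt p))"
    by (intro C2_on_Pair proj)
  have G: "C2_on UNIV ?G"
    unfolding coupled_gradient_def
    by (intro C2_on_linear[OF bounded_linear_riesz] C2_on_add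
        bounded_bilinear.C2_on_prod[OF bounded_bilinear_blinfun_compose]
        C2_on_linear[OF bounded_linear_blinfun_inner_right]
        C2_on_compose[OF f(2) yxt] C2_on_compose[OF c(2) yxt] proj) auto
  have "C2_on UNIV (\<lambda>p. (fst (?G p), snd (?G p) + ?eta p,
      (\<chi> j. ?s p $ j * ?lam p $ j) + - (\<chi> j. \<mu>), c (?y p, ?xt p) + ?s p, ?xt p + - fst p))"
    by (intro C2_on_Pair C2_on_add C2_on_const proj G
        C2_on_linear[OF bounded_linear_minus[OF bounded_linear_ident]]
        bounded_bilinear.C2_on_prod[OF bounded_bilinear_componentwise_times]
        C2_on_compose[OF C3_on_imp_C2_on[OF assms(2)] yxt]) auto
  then show ?thesis
  proof (rule back_subst[where P = "C2_on UNIV"], intro ext)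
    fix p :: "(real^'n0) \<times> ('n, 'n0, 'm) pd_vars"
    obtain x y xt s lam eta where "p = (x, (y, xt, s, lam, eta))"
      by (metis prod.collapse)
    then show "(fst (?G p), snd (?G p) + ?eta p,
        (\<chi> j. ?s p $ j * ?lam p $ j) + - (\<chi> j. \<mu>), c (?y p, ?xt p) + ?s p, ?xt p + - fst p)
      = kkt_map f c \<mu> (snd p) (fst p)"
      by (simp add: kkt_map_eq[OF f(1) c(1)])
  qed
qed

section \<open>Regularity of the local second-stage functions\<close>

text \<open>The envelope theorem.  Along the solution map \<open>s = - c (y, x)\<close>, so the value is
  \<open>f (y, x) - \<mu> * (\<Sum>j. ln (- c (y, x) $ j))\<close>.  Since \<open>\<mu> / s $ j = lam $ j\<close>, its derivative is the coupled
  gradient applied to \<open>(y' d, d)\<close>.  Stationarity makes this gradient \<open>(0, - eta)\<close>, so the unknown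
  derivative of \<open>y\<close> disappears.\<close>

lemma objective_value_derivative:
  fixes w :: "real^'n0::finite \<Rightarrow> ('n::finite, 'n0, 'm::finite) pd_vars"
  assumes f: "derivative_on UNIV f f'" and c: "derivative_on UNIV c c'"
    and w: "C1_solution_map f c \<mu> U w"
  shows "derivative_on U (local_second_stage Objective_Smoothing f \<mu> w)
    (\<lambda>x. - blinfun_inner_right (snd (snd (snd (snd (w x))))))"
  unfolding derivative_on_def
proof
  fix x assume x: "x \<in> U"
  have U: "open U" and S: "\<And>z. z \<in> U \<Longrightarrow> (z, w z) \<in> stationary_set f c \<mu>"
    using w by (auto simp: C1_solution_map_def solution_map_def)
  obtain w' where "derivative_on U w w'"
    using w by (auto simp: C1_solution_map_def C1_on_def)
  then have dw: "(w has_derivative w' x) (at x)"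
    using x by (rule derivative_onD)
  obtain y xt s lam eta where wx: "w x = (y, xt, s, lam, eta)"
    by (metis prod.collapse)
  note st = stationary_setD[OF f c S[OF x, unfolded wx]]
  let ?q = "\<lambda>z. (fst (w z), z)" and ?q' = "\<lambda>d. (fst (w' x d), d)"
  have dq: "(?q has_derivative ?q') (at x)"
    by (intro has_derivative_Pair has_derivative_fst dw has_derivative_ident)
  have df: "((\<lambda>z. f (?q z)) has_derivative (\<lambda>d. f' (?q x) (?q' d))) (at x)"
    by (rule has_derivative_compose[OF dq derivative_onD[OF f UNIV_I]])
  have dc: "((\<lambda>z. c (?q z)) has_derivative (\<lambda>d. c' (?q x) (?q' d))) (at x)"
    by (rule has_derivative_compose[OF dq derivative_onD[OF c UNIV_I]])
  have dln: "((\<lambda>z. \<mu> * ln (- c (?q z) $ j)) has_derivative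
      (\<lambda>d. - (lam $ j * c' (?q x) (?q' d) $ j))) (at x)" for j
  proof -
    have "s $ j = - c (y, x) $ j"
      using st(2) by simp
    then have pos: "0 < - c (?q x) $ j" and mu: "\<mu> = - c (?q x) $ j * lam $ j"
      using st(4,5)[of j] by (simp_all add: wx)
    have "((\<lambda>z. - c (?q z) $ j) has_derivative (\<lambda>d. - c' (?q x) (?q' d) $ j)) (at x)"
      by (intro has_derivative_minus bounded_linear.has_derivative[OF bounded_linear_vec_nth dc])
    from has_derivative_mult_right[OF has_derivative_ln[OF pos this], of \<mu>]
    show ?thesis
      by (rule has_derivative_eq_rhs) (use pos mu in \<open>simp add: fun_eq_iff field_simps\<close>)
  qed
  have "((\<lambda>z. f (?q z) - (\<Sum>j\<in>UNIV. \<mu> * ln (- c (?q z) $ j))) has_derivative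
      (\<lambda>d. f' (?q x) (?q' d) - (\<Sum>j\<in>UNIV. - (lam $ j * c' (?q x) (?q' d) $ j)))) (at x)"
    by (intro has_derivative_diff has_derivative_sum df dln)
  moreover have "f' (?q x) (?q' d) - (\<Sum>j\<in>UNIV. - (lam $ j * c' (?q x) (?q' d) $ j)) = - (eta \<bullet> d)" for d
    using inner_coupled_gradient[of "?q' d" f' c' "?q x" lam] st(3)
    by (simp add: wx sum_negf inner_vec_def[of lam] inner_commute)
  ultimately have "((\<lambda>z. f (?q z) - (\<Sum>j\<in>UNIV. \<mu> * ln (- c (?q z) $ j))) has_derivative
      blinfun_apply (- blinfun_inner_right (snd (snd (snd (snd (w x))))))) (at x)"
    by (simp add: wx uminus_blinfun.rep_eq blinfun_inner_right.rep_eq)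
  then show "(local_second_stage Objective_Smoothing f \<mu> w has_derivative
      blinfun_apply (- blinfun_inner_right (snd (snd (snd (snd (w x))))))) (at x)"
  proof (rule has_derivative_transform_within_open[OF _ U x])
    fix z assume z: "z \<in> U"
    obtain y xt s lam eta where wz: "w z = (y, xt, s, lam, eta)"
      by (metis prod.collapse)
    show "f (?q z) - (\<Sum>j\<in>UNIV. \<mu> * ln (- c (?q z) $ j)) = local_second_stage Objective_Smoothing f \<mu> w z"
      using stationary_setD(2)[OF f c S[OF z, unfolded wz]]
      by (simp add: local_second_stage_def second_stage_value_def wz sum_distrib_left)
  qed
qed

text \<open>The derivative found above involves the solution map but not its derivative.\<close>

lemma objective_value_C2:
  fixes w :: "real^'n0::finite \<Rightarrow> ('n::finite, 'n0, 'm::finite) pd_vars"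
  assumes "C1_on UNIV f" "C1_on UNIV c" and w: "C1_solution_map f c \<mu> U w"
  shows "C2_on U (local_second_stage Objective_Smoothing f \<mu> w)"
proof -
  obtain f' c' where "derivative_on UNIV f f'" "derivative_on UNIV c c'"
    using assms by (auto simp: C1_on_def)
  note d = objective_value_derivative[OF this w]
  have "C1_on U w"
    using w by (simp add: C1_solution_map_def)
  then have "C1_on U (\<lambda>x. - blinfun_inner_right (snd (snd (snd (snd (w x))))))"
    by (intro C1_on_linear[OF bounded_linear_minus[OF bounded_linear_ident]]
        C1_on_linear[OF bounded_linear_blinfun_inner_right] C1_on_linear[OF bounded_linear_snd])
  with d show ?thesis by (auto simp: C2_on_def)
qed

text \<open>Here the derivative of \<open>y\<close> survives in that of the value, so the solution map has to be C2.
  Implicit differentiation gives this only where the KKT matrix is nonsingular, which is guaranteed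
  at \<open>x0\<close> and hence nearby; this is why the ball may be smaller than \<open>U\<close>.\<close>

lemma solution_value_C2:
  fixes w :: "real^'n0::finite \<Rightarrow> ('n::finite, 'n0, 'm::finite) pd_vars"
  assumes f: "C3_on UNIV f" and c: "C3_on UNIV c"
    and w: "C1_solution_map f c \<mu> U w" and x0: "x0 \<in> U"
    and nd: "nondegenerate f c \<mu> (x0, w x0)"
  obtains \<delta> where "0 < \<delta>" "ball x0 \<delta> \<subseteq> U"
    "C2_on (ball x0 \<delta>) (local_second_stage Solution_Smoothing f \<mu> w)"
proof -
  have U: "open U" and C1: "C1_on U w" and S: "\<And>z. z \<in> U \<Longrightarrow> (z, w z) \<in> stationary_set f c \<mu>"
    using w by (auto simp: C1_solution_map_def solution_map_def)
  have zero: "kkt_map f c \<mu> (snd (z, w z)) (fst (z, w z)) = 0" if "z \<in> U" for z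
    using S[OF that] by (auto simp: stationary_set_def)
  obtain D where D: "((\<lambda>v. kkt_map f c \<mu> v x0) has_derivative D) (at (w x0))" "bij D"
    using nd by (auto simp: nondegenerate_def)
  obtain \<delta> where \<delta>: "0 < \<delta>" "ball x0 \<delta> \<subseteq> U" "C2_on (ball x0 \<delta>) w"
    by (rule implicit_function_C2[OF kkt_map_C2[OF f c] C1 U x0 zero _ bij_is_inj[OF D(2)]])
      (use D(1) in simp_all)
  have "C2_on (ball x0 \<delta>) (\<lambda>x. f (fst (w x), x))"
    by (intro C2_on_compose[OF C3_on_imp_C2_on[OF f]] C2_on_Pair C2_on_linear[OF bounded_linear_fst]
        \<delta> bounded_linear_C2_on[OF bounded_linear_ident]) simp
  moreover have "local_second_stage Solution_Smoothing f \<mu> w = (\<lambda>x. f (fst (w x), x))"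
    by (simp add: local_second_stage_def second_stage_value_def fun_eq_iff split_beta)
  ultimately show ?thesis
    using that[OF \<delta>(1,2)] by simp
qed

section \<open>Agreement of solution maps\<close>

lemma local_solution_mapD:
  assumes "local_solution_map f c \<mu> r1 r2 P w"
  shows "0 < r2" "r2 \<le> r1" "C1_solution_map f c \<mu> (ball (fst P) r1) w" "w (fst P) = snd P"
    "\<And>w' x. \<lbrakk>C1_solution_map f c \<mu> (ball (fst P) r1) w'; w' (fst P) = snd P; x \<in> ball (fst P) r1\<rbrakk>
      \<Longrightarrow> w' x = w x"
    "{(x, v). x \<in> ball (fst P) r1 \<and> v = w x} \<inter> ball P r2
       = {(x, v). kkt_map f c \<mu> v x = 0} \<inter> ball P r2"
  by (use assms in \<open>unfold local_solution_map_def has_reference_point_def, blast\<close>)+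

lemma stationary_point_on_graph:
  assumes "local_solution_map f c \<mu> r1 r2 P w"
    and "(x, v) \<in> ball P r2" "(x, v) \<in> stationary_set f c \<mu>"
  shows "x \<in> ball (fst P) r1" "v = w x"
proof -
  have "kkt_map f c \<mu> v x = 0"
    using assms(3) by (auto simp: stationary_set_def)
  then have "(x, v) \<in> {(x, v). kkt_map f c \<mu> v x = 0} \<inter> ball P r2"
    using assms(2) by simp
  also have "\<dots> = {(x, v). x \<in> ball (fst P) r1 \<and> v = w x} \<inter> ball P r2"
    using local_solution_mapD(6)[OF assms(1)] by (rule sym)
  finally show "x \<in> ball (fst P) r1" "v = w x"
    by auto
qed

text \<open>The graph of \<open>w\<close> stays inside \<open>ball P r2\<close> over a small ball around the reference input.  There a
  second solution map \<open>w'\<close> agrees with \<open>w\<close> exactly where its graph lies in \<open>ball P r2\<close>, which is an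
  open condition, and also a closed one.  One meeting point therefore forces \<open>w'\<close> through \<open>P\<close>, and the
  uniqueness among solution maps with reference point \<open>P\<close> gives agreement everywhere.\<close>

lemma solution_maps_meeting_near_reference_agree:
  assumes w: "local_solution_map f c \<mu> r1 r2 P w"
  obtains \<delta> where "0 < \<delta>"
    "\<And>w' x z. \<lbrakk>C1_solution_map f c \<mu> (ball (fst P) r1) w'; x \<in> ball (fst P) \<delta>; w' x = w x;
      z \<in> ball (fst P) r1\<rbrakk> \<Longrightarrow> w' z = w z"
proof -
  have r: "0 < r1" "0 < r2" and w_map: "C1_solution_map f c \<mu> (ball (fst P) r1) w"
    and ref: "w (fst P) = snd P"
    using local_solution_mapD(1-4)[OF w] by simp_all
  then have w_cont: "continuous_on (ball (fst P) r1) w"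
    by (simp add: C1_solution_map_def solution_map_def)
  then have "isCont w (fst P)"
    using r by (simp add: continuous_on_eq_continuous_at)
  then have "isCont (\<lambda>z. (z, w z)) (fst P)"
    by (intro continuous_intros)
  then obtain d where d: "0 < d" "\<And>z. dist z (fst P) < d \<Longrightarrow> dist (z, w z) (fst P, w (fst P)) < r2"
    unfolding continuous_at_eps_delta using r by blast
  define \<delta> where "\<delta> = min d r1"
  let ?B = "ball (fst P) \<delta>"
  have sub: "?B \<subseteq> ball (fst P) r1"
    by (auto simp: \<delta>_def)
  have near: "(z, w z) \<in> ball P r2" if "z \<in> ?B" for z
    using d(2)[of z] that ref by (simp add: \<delta>_def dist_commute)
  have "w' z = w z" if w': "C1_solution_map f c \<mu> (ball (fst P) r1) w'"
    and x: "x \<in> ?B" "w' x = w x" and z: "z \<in> ball (fst P) r1" for w' x z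
  proof -
    have w'_cont: "continuous_on ?B w'"
      and S: "\<And>u. u \<in> ?B \<Longrightarrow> (u, w' u) \<in> stationary_set f c \<mu>"
      using w' sub continuous_on_subset[OF _ sub] by (auto simp: C1_solution_map_def solution_map_def)
    have "{u \<in> ?B. w' u - w u = 0} = (\<lambda>u. (u, w' u)) -` ball P r2 \<inter> ?B"
    proof (intro set_eqI iffI)
      fix u assume "u \<in> {u \<in> ?B. w' u - w u = 0}"
      then have "u \<in> ?B" "w' u = w u" by simp_all
      with near[of u] show "u \<in> (\<lambda>u. (u, w' u)) -` ball P r2 \<inter> ?B" by simp
    next
      fix u assume "u \<in> (\<lambda>u. (u, w' u)) -` ball P r2 \<inter> ?B"
      then have u: "u \<in> ?B" "(u, w' u) \<in> ball P r2" by (simp_all only: Int_iff vimage_eq)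
      have "w' u = w u"
        by (rule stationary_point_on_graph(2)[OF w u(2) S[OF u(1)]])
      with u(1) show "u \<in> {u \<in> ?B. w' u - w u = 0}" by simp
    qed
    moreover have "open ((\<lambda>u. (u, w' u)) -` ball P r2 \<inter> ?B)"
      by (rule iffD1[OF continuous_on_open_vimage[OF open_ball], rule_format, OF _ open_ball])
        (intro continuous_on_Pair continuous_on_id w'_cont)
    ultimately have "open {u \<in> ?B. w' u - w u = 0}"
      by simp
    then have "\<forall>u\<in>?B. w' u - w u = 0"
      using x
      by (intro continuous_levelset_open convex_connected convex_ball continuous_on_diff w'_cont
          continuous_on_subset[OF w_cont sub]) auto
    then have "w' (fst P) = snd P"
      using ref d(1) r by (simp add: \<delta>_def)
    then show ?thesis
      by (rule local_solution_mapD(5)[OF w w' _ z])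
  qed
  moreover have "0 < \<delta>"
    using d(1) r by (simp add: \<delta>_def)
  ultimately show ?thesis
    using that by blast
qed

section \<open>Warm-started solves near a nondegenerate point\<close>

theorem proposition5p6:
  fixes sm :: smoothing
    and \<mu> :: real
    and f0 :: "real^'n0 \<Rightarrow> real"
    and c0 :: "real^'n0 \<Rightarrow> real^'m0"
    and f :: "(real^'n) \<times> (real^'n0) \<Rightarrow> real"
    and c :: "(real^'n) \<times> (real^'n0) \<Rightarrow> real^'m"
    and r1 r2 :: "(real^'n0) \<times> ('n, 'n0, 'm) pd_vars \<Rightarrow> real"
    and vstar :: "(real^'n0) \<times> ('n, 'n0, 'm) pd_vars \<Rightarrow> real^'n0 \<Rightarrow> ('n, 'n0, 'm) pd_vars"
    and X :: "(real^'n0) set"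
    and solver :: "real^'n0 \<Rightarrow> ('n, 'n0, 'm) pd_vars \<Rightarrow> ('n, 'n0, 'm) pd_vars"
    and xbar :: "real^'n0"
    and vbar :: "('n, 'n0, 'm) pd_vars"
  assumes "\<mu> > 0"
    and vstar: "\<And>P. nondegenerate f c \<mu> P \<Longrightarrow> local_solution_map f c \<mu> (r1 P) (r2 P) P (vstar P)"
    and "feasibility_assumption f c \<mu> X solver"
    and "regularity_assumption sm f0 c0 f c"
    and "consistent_output_assumption f c \<mu> r2 X solver"
    and "nondegenerate f c \<mu> (xbar, vbar)"
  shows "\<exists>r>0. \<forall>x v. (x, v) \<in> ball (xbar, vbar) r \<inter> stationary_set f c \<mu> \<longrightarrow>
    \<comment> \<open>(i)\<close>
    (C1_solution_map f c \<mu> (ball xbar (r1 (xbar, vbar))) (vstar (xbar, vbar)) \<and>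
     has_reference_point (vstar (xbar, vbar)) (xbar, vbar) \<and>
     x \<in> ball xbar (r1 (xbar, vbar)) \<and> v = vstar (xbar, vbar) x \<and>
     (\<forall>w. C1_solution_map f c \<mu> (ball xbar (r1 (xbar, vbar))) w \<and> v = w x
        \<longrightarrow> (\<forall>z\<in>ball xbar (r1 (xbar, vbar)). w z = vstar (xbar, vbar) z))) \<and>
    \<comment> \<open>(ii)\<close>
    (\<forall>d. norm d \<le> r \<and> x \<in> X \<and> (\<exists>v0. v = solver x v0) \<and> x + d \<in> X \<and>
       second_stage_value sm f \<mu> x v = local_second_stage sm f \<mu> (vstar (xbar, vbar)) x
       \<longrightarrow> x + d \<in> ball xbar (r1 (xbar, vbar)) \<and>
           second_stage_value sm f \<mu> (x + d) (solver (x + d) v)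
             = local_second_stage sm f \<mu> (vstar (xbar, vbar)) (x + d)) \<and>
    \<comment> \<open>(iii)\<close>
    (ball xbar r \<subseteq> ball xbar (r1 (xbar, vbar)) \<and>
     C2_on (ball xbar r) (local_second_stage sm f \<mu> (vstar (xbar, vbar))))"
proof -
  let ?P = "(xbar, vbar)"
  let ?w = "vstar ?P"
  let ?r1 = "r1 ?P" and ?r2 = "r2 ?P"
  note nd = \<open>nondegenerate f c \<mu> ?P\<close>
  note loc = vstar[OF nd]
  have r12: "0 < ?r2" "?r2 \<le> ?r1" and w_map: "C1_solution_map f c \<mu> (ball xbar ?r1) ?w"
    and ref: "has_reference_point ?w ?P"
    using local_solution_mapD(1-4)[OF loc] by (simp_all add: has_reference_point_def)
  obtain \<delta> where \<delta>: "0 < \<delta>"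
    and agree: "\<And>w' x z. \<lbrakk>C1_solution_map f c \<mu> (ball xbar ?r1) w'; x \<in> ball xbar \<delta>;
      w' x = ?w x; z \<in> ball xbar ?r1\<rbrakk> \<Longrightarrow> w' z = ?w z"
    using solution_maps_meeting_near_reference_agree[OF loc] unfolding fst_conv by blast
  obtain r3 where r3: "0 < r3"
    and consistent: "\<forall>xk vk d. xk \<in> X \<and> (\<exists>v0. vk = solver xk v0) \<and>
      (xk, vk) \<in> stationary_set f c \<mu> \<and> (xk, vk) \<in> ball ?P r3 \<and> xk + d \<in> X \<and> norm d \<le> r3
      \<longrightarrow> (xk + d, solver (xk + d) vk) \<in> ball ?P ?r2"
    using \<open>consistent_output_assumption f c \<mu> r2 X solver\<close>[unfolded consistent_output_assumption_def,
        rule_format, OF nd] by (elim exE conjE)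
  obtain \<rho> where \<rho>: "0 < \<rho>" "C2_on (ball xbar \<rho>) (local_second_stage sm f \<mu> ?w)"
  proof (cases sm)
    case Objective_Smoothing
    then have "C1_on UNIV f" "C1_on UNIV c"
      using \<open>regularity_assumption sm f0 c0 f c\<close>
      by (auto simp: regularity_assumption_def intro: C2_lipschitz_on_imp_C1_on)
    from objective_value_C2[OF this w_map] have "C2_on (ball xbar ?r1) (local_second_stage sm f \<mu> ?w)"
      by (simp only: Objective_Smoothing)
    then show ?thesis
      by (intro that[of ?r1]) (use r12 in simp_all)
  next
    case Solution_Smoothing
    then have C3: "C3_on UNIV f" "C3_on UNIV c"
      using \<open>regularity_assumption sm f0 c0 f c\<close> by (auto simp: regularity_assumption_def)
    have "nondegenerate f c \<mu> (xbar, ?w xbar)" "xbar \<in> ball xbar ?r1"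
      using nd ref r12 by (simp_all add: has_reference_point_def)
    from solution_value_C2[OF C3 w_map this(2,1)]
    obtain \<rho> where "0 < \<rho>" "C2_on (ball xbar \<rho>) (local_second_stage Solution_Smoothing f \<mu> ?w)" .
    then show ?thesis
      by (intro that[of \<rho>]) (simp_all only: Solution_Smoothing)
  qed
  \<comment> \<open>Inside \<open>?r2\<close> stationary points lie on the graph, inside \<open>\<delta>\<close> solution maps that meet agree,
    within \<open>r3\<close> the solver output is consistent, and on the \<open>\<rho>\<close>-ball the local function is C2.\<close>
  define r where "r = Min {?r2, \<delta>, r3, \<rho>}"
  have r: "0 < r" "r \<le> ?r2" "r \<le> \<delta>" "r \<le> r3" "r \<le> \<rho>"
    using r12 \<delta> r3 \<rho> by (auto simp: r_def)
  show ?thesis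
  proof (intro exI[of _ r] conjI allI impI ballI)
    show "0 < r" by (rule r)
    show "ball xbar r \<subseteq> ball xbar ?r1"
      using r r12 by (intro subset_ball) simp
    show "C2_on (ball xbar r) (local_second_stage sm f \<mu> ?w)"
      using \<rho>(2) by (rule C2_on_subset) (intro subset_ball r)
    show "C1_solution_map f c \<mu> (ball xbar ?r1) ?w" "has_reference_point ?w ?P"
      by (fact w_map, fact ref)
  next
    fix x v assume "(x, v) \<in> ball ?P r \<inter> stationary_set f c \<mu>"
    then have ball: "(x, v) \<in> ball ?P r" and S: "(x, v) \<in> stationary_set f c \<mu>"
      by auto
    have "(x, v) \<in> ball ?P ?r2"
      using ball r by simp
    note graph = stationary_point_on_graph[OF loc this S]
    show "x \<in> ball xbar ?r1" "v = ?w x"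
      using graph by simp_all
    have "x \<in> ball xbar r"
      using ball dist_fst_le[of ?P "(x, v)"] by simp
    then have x: "x \<in> ball xbar \<delta>"
      using r by simp
    show "w z = ?w z"
      if "C1_solution_map f c \<mu> (ball xbar ?r1) w \<and> v = w x" "z \<in> ball xbar ?r1" for w z
    proof (rule agree[OF _ x _ that(2)])
      show "C1_solution_map f c \<mu> (ball xbar ?r1) w"
        using that(1) by (rule conjunct1)
      show "w x = ?w x"
        using that(1) graph(2) by (metis (no_types))
    qed
    fix d assume "norm d \<le> r \<and> x \<in> X \<and> (\<exists>v0. v = solver x v0) \<and> x + d \<in> X \<and>
      second_stage_value sm f \<mu> x v = local_second_stage sm f \<mu> ?w x"
    then have d: "norm d \<le> r" "x \<in> X" "\<exists>v0. v = solver x v0" "x + d \<in> X"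
      by auto
    have "(x, v) \<in> ball ?P r3" "norm d \<le> r3"
      using ball d(1) r by simp_all
    then have "(x + d, solver (x + d) v) \<in> ball ?P ?r2"
      using consistent[rule_format, of x v d] d S by simp
    moreover have "(x + d, solver (x + d) v) \<in> stationary_set f c \<mu>"
      using \<open>feasibility_assumption f c \<mu> X solver\<close> d(4)
      unfolding feasibility_assumption_def by blast
    ultimately have "x + d \<in> ball xbar ?r1" "solver (x + d) v = ?w (x + d)"
      using stationary_point_on_graph[OF loc, of "x + d" "solver (x + d) v"] by simp_all
    then show "x + d \<in> ball xbar ?r1"
      "second_stage_value sm f \<mu> (x + d) (solver (x + d) v) = local_second_stage sm f \<mu> ?w (x + d)"
      by (simp_all add: local_second_stage_def)
  qed
qed

end
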